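(* Fix an integer $k\ge1$. For each of the three families of graphs $G_q=\mathrm{Kn}(q,k)$, $G_q=J(q,k)$, and $G_q=K_q^k$ ($q\in\mathbb N$), the matching polynomial $\mu_{G_q}(n)$ is a two-level polynomial of infinite depth.
   Context: $\mathbb N=\{0,1,2,\dots\}$, $[q]=\{1,\dots,q\}$. For a graph $G$ with $d$ vertices, let $\mathcal M_i(G)$ be the set of $i$-matchings of $G$ (sets of $i$ edges involving $2i$ distinct vertices); the matching polynomial is $\mu_G(n)=\sum_{i\ge0}(-1)^i|\mathcal M_i(G)|\,n^{d-2i}$. The Kneser graph $\mathrm{Kn}(q,k)$ has vertices the $k$-subsets of $[q]$, adjacent iff disjoint. The Johnson graph $J(q,k)$ has vertices the $k$-subsets of $[q]$, adjacent iff they share exactly $k-1$ elements. $K_q^k$ is the Cartesian product of $k$ copies of the complete graph $K_q$: vertex set $[q]^k$, two tuples adjacent iff they differ in exactly one coordinate. A numerical polynomial is $g\in\mathbb Q[x]$ with $g(q)\in\mathbb Z$ for all $q\in\mathbb Z$. Two-level polynomial: let $g$ be an eventually nonnegative numerical polynomial, $S=\{q\in\mathbb N: g(q)\ge0\}$, $e:S\to\mathbb N\cup\{-1,\infty\}$. A two-level polynomial of degree function $g$ and depth function $e$ is a sequence of polynomials $\{f_q\}_{q\in S}$, $f_q(n)$ of degree $g(q)$, such that, writing $f_q(n)=\sum_{r\ge0}c_r(q)n^{g(q)-r}$ with $c_r(q)=0$ for $r>g(q)$, there exist polynomials $\{\phi_r(q)\}_{r\ge0}$ with $c_r(q)=\phi_r(q)$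 for every $q\in S$ and every $r\le e(q)$. Infinite depth means $e(q)=\infty$ for all $q\in S$, i.e. the equality holds for all $r\ge 0$ (including $r>g(q)$, where $\phi_r(q)=0$). Here the degree function is the number of vertices of $G_q$. *)

theory Defs
  imports Complex_Main "HOL-Computational_Algebra.Polynomial" "HOL-Library.Extended_Real"
begin

text \<open>A simple graph is given by its vertex set and its set of edges, an edge being a two-element
  set of vertices.\<close>

type_synonym 'a ugraph = "'a set \<times> 'a set set"

definition verts :: "'a ugraph \<Rightarrow> 'a set" where
  "verts G = fst G"

definition edges :: "'a ugraph \<Rightarrow> 'a set set" where
  "edges G = snd G"

definition graph_of :: "'a set \<Rightarrow> ('a \<Rightarrow> 'a \<Rightarrow> bool) \<Rightarrow> 'a ugraph" where
  "graph_of V adj = (V, {{u, v} | u v. u \<in> V \<and> v \<in> V \<and> u \<noteq> v \<and> adj u v})"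

definition matchings :: "'a ugraph \<Rightarrow> nat \<Rightarrow> 'a set set set" where
  "matchings G i = {M. M \<subseteq> edges G \<and> finite M \<and> card M = i \<and> card (\<Union>M) = 2 * i}"

text \<open>For a finite graph with \<open>d\<close> vertices there are no \<open>i\<close>-matchings when \<open>2 * i > d\<close>, so the sum
  over all \<open>i\<close> stops at \<open>d div 2\<close>; in this range the exponent is not truncated.\<close>

definition matching_poly :: "'a ugraph \<Rightarrow> rat poly" where
  "matching_poly G =
     (\<Sum>i\<le>card (verts G) div 2.
        monom ((-1) ^ i * of_nat (card (matchings G i))) (card (verts G) - 2 * i))"

definition subsets_of_size :: "nat \<Rightarrow> nat \<Rightarrow> nat set set" where
  "subsets_of_size q k = {A. A \<subseteq> {1..q} \<and> card A = k}"

definition kneser_graph :: "nat \<Rightarrow> nat \<Rightarrow> nat set ugraph" where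
  "kneser_graph q k = graph_of (subsets_of_size q k) (\<lambda>A B. A \<inter> B = {})"

text \<open>Only meaningful for \<open>k \<ge> 1\<close>, because of the subtraction on \<^typ>\<open>nat\<close>.\<close>

definition johnson_graph :: "nat \<Rightarrow> nat \<Rightarrow> nat set ugraph" where
  "johnson_graph q k = graph_of (subsets_of_size q k) (\<lambda>A B. card (A \<inter> B) = k - 1)"

text \<open>The Cartesian power \<open>K\<^sub>q\<^sup>k\<close>, with \<open>k\<close>-tuples represented as lists of length \<open>k\<close>.\<close>

definition complete_power_graph :: "nat \<Rightarrow> nat \<Rightarrow> nat list ugraph" where
  "complete_power_graph q k =
     graph_of {xs. length xs = k \<and> set xs \<subseteq> {1..q}}
       (\<lambda>xs ys. card {i. i < k \<and> xs ! i \<noteq> ys ! i} = 1)"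

definition numerical_poly :: "rat poly \<Rightarrow> bool" where
  "numerical_poly g \<longleftrightarrow> (\<forall>q::int. poly g (of_int q) \<in> \<int>)"

definition nonneg_set :: "rat poly \<Rightarrow> nat set" where
  "nonneg_set g = {q. poly g (of_nat q) \<ge> 0}"

text \<open>The coefficient of \<open>n\<close> to the power \<open>degree p - r\<close>, which is \<open>0\<close> for \<open>r > degree p\<close>.\<close>

definition top_coeff :: "rat poly \<Rightarrow> nat \<Rightarrow> rat" where
  "top_coeff p r = (if r \<le> degree p then coeff p (degree p - r) else 0)"

text \<open>\<open>two_level_poly g e f\<close>: the family of the \<open>f q\<close> with \<open>q \<in> nonneg_set g\<close> is a two-level
  polynomial of degree function \<open>g\<close> and depth function \<open>e\<close>. The values of \<open>e\<close> and \<open>f\<close> outside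
  \<open>nonneg_set g\<close> are irrelevant. The zero polynomial, which has \<^const>\<open>degree\<close> \<open>0\<close> in the library,
  is excluded explicitly.\<close>

definition two_level_poly :: "rat poly \<Rightarrow> (nat \<Rightarrow> ereal) \<Rightarrow> (nat \<Rightarrow> rat poly) \<Rightarrow> bool" where
  "two_level_poly g e f \<longleftrightarrow>
     numerical_poly g \<and>
     (\<forall>\<^sub>F q::nat in sequentially. poly g (of_nat q) \<ge> 0) \<and>
     (\<forall>q\<in>nonneg_set g. e q = -1 \<or> e q = \<infinity> \<or> (\<exists>m::nat. e q = ereal (real m))) \<and>
     (\<forall>q\<in>nonneg_set g. f q \<noteq> 0 \<and> of_nat (degree (f q)) = poly g (of_nat q)) \<and>
     (\<exists>\<phi> :: nat \<Rightarrow> rat poly. \<forall>q\<in>nonneg_set g. \<forall>r::nat.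
        ereal (real r) \<le> e q \<longrightarrow> top_coeff (f q) r = poly (\<phi> r) (of_nat q))"

text \<open>A two-level polynomial of infinite depth. The degree function is a parameter, so that it can
  be tied to the number of vertices.\<close>

definition two_level_poly_infinite_depth :: "rat poly \<Rightarrow> (nat \<Rightarrow> rat poly) \<Rightarrow> bool" where
  "two_level_poly_infinite_depth g f \<longleftrightarrow> two_level_poly g (\<lambda>_. \<infinity>) f"

end

theory Submission
  imports Defs
begin

text \<open>
  The vertices of all three families carry labels from \<open>{1..q}\<close>: a \<open>k\<close>-subset has its elements as
  labels, a tuple has its entries. Whether two vertices are adjacent does not depend on \<open>q\<close>, so each
  family consists of the induced subgraphs \<open>G\<^sub>q\<close>, on the vertices with all labels in \<open>{1..q}\<close>, of
  one infinite graph labelled by natural numbers. Moreover an injective relabelling of the numbers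
  preserves adjacency.

  An \<open>i\<close>-matching of \<open>G\<^sub>q\<close> is then an \<open>i\<close>-matching of the infinite graph whose set of labels, its
  support, is contained in \<open>{1..q}\<close>. It has \<open>2 i\<close> vertices with boundedly many labels each, so the
  size of the support is at most some \<open>N\<close> independent of \<open>q\<close>. By relabelling, the number of
  \<open>i\<close>-matchings with support exactly \<open>S\<close> is a number \<open>a\<^sub>s\<close> that depends only on \<open>s = card S\<close>.
  Grouping the matchings of \<open>G\<^sub>q\<close> by their supports gives
  \<open>\<Sum>s\<le>N. a\<^sub>s * (q choose s)\<close> of them, which is polynomial in \<open>q\<close> for every natural number \<open>q\<close>, without
  exceptions for small \<open>q\<close> (lemma \<open>card_supported_eq_numerical_poly\<close>). The same lemma, applied to
  vertices instead of matchings, shows that the number of vertices is a numerical polynomial.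
  Since the coefficients of the matching polynomial are, up to sign, the numbers of
  matchings, this is infinite depth.
\<close>

section \<open>Binomial coefficients as numerical polynomials\<close>

definition binomial_poly :: "nat \<Rightarrow> rat poly" where
  "binomial_poly s = smult (1 / fact s) (\<Prod>i=0..<s. [:- of_nat i, 1:])"

lemma poly_binomial_poly: "poly (binomial_poly s) x = x gchoose s"
  by (simp add: binomial_poly_def gbinomial_prod_rev poly_prod)

text \<open>A negative upper index is reflected into a natural number by
  \<open>a gchoose s = (-1) ^ s * ((s - a - 1) gchoose s)\<close>.\<close>

lemma gbinomial_of_int_in_Ints: "((of_int a :: 'a::field_char_0) gchoose s) \<in> \<int>"
proof (cases "a \<ge> 0")
  case True
  then have "(of_int a :: 'a) = of_nat (nat a)" by simp
  then show ?thesis by (metis Ints_of_nat binomial_gbinomial)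
next
  case False
  then have "of_nat s - of_int a - 1 = (of_nat (nat (int s - a - 1)) :: 'a)" by simp
  then have "(of_nat s - of_int a - 1 :: 'a) gchoose s \<in> \<int>"
    by (metis Ints_of_nat binomial_gbinomial)
  then show ?thesis
    by (subst gbinomial_negated_upper) (intro Ints_mult Ints_power; simp)
qed

lemma binomial_combination_eq_numerical_poly:
  fixes a :: "nat \<Rightarrow> nat"
  shows "\<exists>g. numerical_poly g \<and> (\<forall>q. poly g (of_nat q) = of_nat (\<Sum>s\<le>N. a s * (q choose s)))"
proof (intro exI conjI allI)
  let ?g = "\<Sum>s\<le>N. smult (of_nat (a s)) (binomial_poly s)"
  show "numerical_poly ?g"
    by (auto simp: numerical_poly_def poly_sum poly_binomial_poly
        intro!: Ints_sum Ints_mult gbinomial_of_int_in_Ints)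
  show "poly ?g (of_nat q) = of_nat (\<Sum>s\<le>N. a s * (q choose s))" for q
    by (simp add: poly_sum poly_binomial_poly binomial_gbinomial)
qed

section \<open>Counting objects by their supports\<close>

text \<open>Outside \<open>S\<close> the injection can simply shift everything beyond \<open>T\<close>.\<close>

lemma inj_nat_mapping_finite_set:
  fixes S T :: "nat set"
  assumes "finite S" "finite T" "card S = card T"
  obtains p where "inj p" "p ` S = T"
proof -
  obtain f where f: "bij_betw f S T"
    using assms finite_same_card_bij by blast
  obtain m where m: "T \<subseteq> {..<m}"
    using assms(2) finite_nat_iff_bounded by blast
  define p where "p = (\<lambda>x. if x \<in> S then f x else m + x)"
  have less: "f x < m" if "x \<in> S" for x
    using that f m by (auto simp: bij_betw_def)
  have "inj p"
  proof (rule injI)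
    fix x y assume "p x = p y"
    then show "x = y"
      using less[of x] less[of y] f
      by (auto simp: p_def bij_betw_def inj_on_def split: if_splits)
  qed
  moreover have "p ` S = T"
    using f by (auto simp: p_def bij_betw_def)
  ultimately show ?thesis by (rule that)
qed

text \<open>The objects with support contained in \<open>{1..q}\<close> are partitioned by their supports. The number
  of those with support \<open>S\<close> depends only on \<open>card S\<close>, because any two label sets of the same size
  are related by injective relabellings in both directions; and there are \<open>q choose s\<close> supports of
  size \<open>s\<close>.\<close>

lemma card_supported_eq_numerical_poly:
  fixes X :: "'x set" and supp :: "'x \<Rightarrow> nat set" and act :: "(nat \<Rightarrow> nat) \<Rightarrow> 'x \<Rightarrow> 'x"
  assumes fin_supp: "\<And>x. x \<in> X \<Longrightarrow> finite (supp x)"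
    and card_supp: "\<And>x. x \<in> X \<Longrightarrow> card (supp x) \<le> N"
    and fin: "\<And>S. finite S \<Longrightarrow> finite {x \<in> X. supp x \<subseteq> S}"
    and act_closed: "\<And>p x. inj p \<Longrightarrow> x \<in> X \<Longrightarrow> act p x \<in> X"
    and supp_act: "\<And>p x. inj p \<Longrightarrow> x \<in> X \<Longrightarrow> supp (act p x) = p ` supp x"
    and inj_act: "\<And>p. inj p \<Longrightarrow> inj_on (act p) X"
  shows "\<exists>g. numerical_poly g \<and>
             (\<forall>q. poly g (of_nat q) = of_nat (card {x \<in> X. supp x \<subseteq> {1..q}}))"
proof -
  define F where "F S = {x \<in> X. supp x = S}" for S
  have fin_F: "finite (F S)" if "finite S" for S
    by (rule finite_subset[OF _ fin[OF that]]) (auto simp: F_def)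
  have le: "card (F S) \<le> card (F T)" if "finite S" "finite T" "card S = card T" for S T
  proof -
    from that obtain p where p: "inj p" "p ` S = T"
      by (rule inj_nat_mapping_finite_set)
    show ?thesis
    proof (rule card_inj_on_le)
      show "inj_on (act p) (F S)"
        using inj_act[OF p(1)] by (rule inj_on_subset) (auto simp: F_def)
      show "act p ` F S \<subseteq> F T"
        using p act_closed supp_act by (auto simp: F_def)
      show "finite (F T)" using fin_F that by blast
    qed
  qed
  define a where "a s = card (F {1..s})" for s
  have card_F: "card (F S) = a (card S)" if "finite S" for S
    unfolding a_def using le[of S "{1..card S}"] le[of "{1..card S}" S] that by force
  have "card {x \<in> X. supp x \<subseteq> {1..q}} = (\<Sum>s\<le>N. a s * (q choose s))" for q
  proof -
    define I where "I = {S. S \<subseteq> {1..q} \<and> card S \<le> N}"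
    have fin_I: "finite I" by (rule finite_subset[of _ "Pow {1..q}"]) (auto simp: I_def)
    have fin_S: "finite S" if "S \<in> I" for S
      using that finite_subset by (auto simp: I_def)
    have "{x \<in> X. supp x \<subseteq> {1..q}} = (\<Union>S\<in>I. F S)"
      using card_supp by (auto simp: I_def F_def)
    also have "card \<dots> = (\<Sum>S\<in>I. card (F S))"
      by (rule card_UN_disjoint) (use fin_I fin_S fin_F in \<open>auto simp: F_def\<close>)
    also have "\<dots> = (\<Sum>S\<in>I. a (card S))"
      using card_F fin_S by simp
    also have "\<dots> = (\<Sum>s\<le>N. \<Sum>S\<in>{S \<in> I. card S = s}. a (card S))"
      by (rule sum.group[symmetric]) (use fin_I in \<open>auto simp: I_def\<close>)
    also have "\<dots> = (\<Sum>s\<le>N. a s * (q choose s))"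
    proof (rule sum.cong[OF refl])
      fix s assume "s \<in> {..N}"
      then have "{S \<in> I. card S = s} = {S. S \<subseteq> {1..q} \<and> card S = s}"
        by (auto simp: I_def)
      then have "card {S \<in> I. card S = s} = q choose s"
        using n_subsets[of "{1..q}" s] by simp
      then show "(\<Sum>S\<in>{S \<in> I. card S = s}. a (card S)) = a s * (q choose s)"
        by simp
    qed
    finally show ?thesis .
  qed
  then show ?thesis
    using binomial_combination_eq_numerical_poly[of a N] by simp
qed

section \<open>Coefficients of the matching polynomial\<close>

lemma matchings_zero: "matchings G 0 = {{}}"
  by (auto simp: matchings_def)

lemma matchings_eq_empty_if_too_large:
  assumes "finite (verts G)" "edges G \<subseteq> Pow (verts G)" "card (verts G) < 2 * i"
  shows "matchings G i = {}"
proof (rule ccontr)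
  assume "matchings G i \<noteq> {}"
  then obtain M where M: "M \<subseteq> edges G" "card (\<Union>M) = 2 * i"
    by (auto simp: matchings_def)
  with assms(2) have "\<Union>M \<subseteq> verts G" by blast
  with assms(1) have "card (\<Union>M) \<le> card (verts G)" by (rule card_mono)
  with M assms(3) show False by simp
qed

lemma coeff_matching_poly:
  assumes "r \<le> card (verts G)"
  shows "coeff (matching_poly G) (card (verts G) - r) =
    (if even r then (-1) ^ (r div 2) * of_nat (card (matchings G (r div 2))) else 0)"
proof -
  let ?d = "card (verts G)"
  let ?c = "\<lambda>i. (-1) ^ i * of_nat (card (matchings G i)) :: rat"
  have "coeff (matching_poly G) (?d - r) =
      (\<Sum>i\<le>?d div 2. if i = r div 2 \<and> even r then ?c i else 0)"
    unfolding matching_poly_def coeff_sum coeff_monom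
  proof (rule sum.cong[OF refl])
    fix i assume "i \<in> {..?d div 2}"
    with assms have "?d - 2 * i = ?d - r \<longleftrightarrow> i = r div 2 \<and> even r"
      by (auto elim!: evenE) presburger+
    then show "(if ?d - 2 * i = ?d - r then ?c i else 0) = (if i = r div 2 \<and> even r then ?c i else 0)"
      by simp
  qed
  also have "\<dots> = (if even r then ?c (r div 2) else 0)"
    using assms by (auto simp: div_le_mono)
  finally show ?thesis .
qed

lemma degree_matching_poly:
  "degree (matching_poly G) = card (verts G)" and matching_poly_nonzero: "matching_poly G \<noteq> 0"
proof -
  have lead: "coeff (matching_poly G) (card (verts G)) = 1"
    using coeff_matching_poly[of 0 G] by (simp add: matchings_zero)
  then show "matching_poly G \<noteq> 0" by auto
  have "degree (matching_poly G) \<le> card (verts G)"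
    unfolding matching_poly_def
    by (intro degree_sum_le) (auto intro: order_trans[OF degree_monom_le])
  moreover have "card (verts G) \<le> degree (matching_poly G)"
    using lead by (intro le_degree) simp
  ultimately show "degree (matching_poly G) = card (verts G)" by simp
qed

text \<open>Past the degree, where the top coefficients are zero by convention, the formula persists
  because there are no matchings with more than \<open>card (verts G)\<close> vertices. Therefore polynomiality of
  the matching numbers gives infinite depth.\<close>

lemma top_coeff_matching_poly:
  assumes "finite (verts G)" "edges G \<subseteq> Pow (verts G)"
  shows "top_coeff (matching_poly G) r =
    (if even r then (-1) ^ (r div 2) * of_nat (card (matchings G (r div 2))) else 0)"
proof (cases "r \<le> card (verts G)")
  case True
  then show ?thesis
    by (simp add: top_coeff_def degree_matching_poly coeff_matching_poly)
next
  case False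
  then show ?thesis
    using matchings_eq_empty_if_too_large[OF assms, of "r div 2"]
    by (auto simp: top_coeff_def degree_matching_poly)
qed

section \<open>Graphs labelled by natural numbers\<close>

lemma verts_graph_of [simp]: "verts (graph_of V adj) = V"
  by (simp add: graph_of_def verts_def)

lemma edges_graph_of:
  "edges (graph_of V adj) = {{u, v} | u v. u \<in> V \<and> v \<in> V \<and> u \<noteq> v \<and> adj u v}"
  by (simp add: graph_of_def edges_def)

text \<open>The infinite graph \<open>(V, adj)\<close> from which a family of graphs is cut out by restricting the
  labels to \<open>{1..q}\<close>. Relabellings are arbitrary injections \<open>nat \<Rightarrow> nat\<close> instead of permutations:
  any bijection between finite label sets extends to one by a shift. The price is that a relabelling
  need not have an inverse, so adjacency is assumed to be preserved in one direction only, and equalities of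
  cardinalities come from a pair of injective relabellings. The uniform bound \<open>b\<close> on the number of
  labels of a vertex is what bounds the degree of the counting polynomials.\<close>

locale labelled_graph =
  fixes V :: "'v set" and adj :: "'v \<Rightarrow> 'v \<Rightarrow> bool"
    and labels :: "'v \<Rightarrow> nat set" and relabel :: "(nat \<Rightarrow> nat) \<Rightarrow> 'v \<Rightarrow> 'v" and b :: nat
  assumes finite_labels: "v \<in> V \<Longrightarrow> finite (labels v)"
    and card_labels: "v \<in> V \<Longrightarrow> card (labels v) \<le> b"
    and finite_labelled_within: "finite S \<Longrightarrow> finite {v \<in> V. labels v \<subseteq> S}"
    and relabel_closed: "inj p \<Longrightarrow> v \<in> V \<Longrightarrow> relabel p v \<in> V"
    and labels_relabel: "inj p \<Longrightarrow> v \<in> V \<Longrightarrow> labels (relabel p v) = p ` labels v"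
    and inj_relabel: "inj p \<Longrightarrow> inj_on (relabel p) V"
    and adj_relabel: "inj p \<Longrightarrow> u \<in> V \<Longrightarrow> v \<in> V \<Longrightarrow> adj u v \<Longrightarrow> adj (relabel p u) (relabel p v)"
begin

definition level :: "nat \<Rightarrow> 'v ugraph" where
  "level q = graph_of {v \<in> V. labels v \<subseteq> {1..q}} adj"

definition matching_labels :: "'v set set \<Rightarrow> nat set" where
  "matching_labels M = (\<Union>v\<in>\<Union>M. labels v)"

lemma matchings_level:
  "matchings (level q) i = {M \<in> matchings (graph_of V adj) i. matching_labels M \<subseteq> {1..q}}"
proof -
  have "edges (level q) = {e \<in> edges (graph_of V adj). \<forall>v\<in>e. labels v \<subseteq> {1..q}}"
    unfolding level_def edges_graph_of by (intro set_eqI) (simp, blast)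
  moreover have "M \<subseteq> {e \<in> E. \<forall>v\<in>e. P v} \<longleftrightarrow> M \<subseteq> E \<and> (\<forall>v\<in>\<Union>M. P v)"
    for M E and P :: "'v \<Rightarrow> bool"
    by blast
  ultimately have "M \<subseteq> edges (level q) \<longleftrightarrow>
      M \<subseteq> edges (graph_of V adj) \<and> matching_labels M \<subseteq> {1..q}" for M
    unfolding matching_labels_def UN_subset_iff by (simp only:)
  then show ?thesis
    unfolding matchings_def by (simp only: mem_Collect_eq conj_ac)
qed

lemma matching_vertices:
  assumes "M \<in> matchings (graph_of V adj) i"
  shows "\<Union>M \<subseteq> V" "finite (\<Union>M)" "card (\<Union>M) = 2 * i"
  using assms by (auto simp: matchings_def edges_graph_of)

lemma relabel_matching:
  assumes p: "inj p" and M: "M \<in> matchings (graph_of V adj) i"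
  shows "image (relabel p) ` M \<in> matchings (graph_of V adj) i"
proof -
  note V = matching_vertices[OF M]
  have inj: "inj_on (relabel p) V" by (rule inj_relabel[OF p])
  have "relabel p ` e \<in> edges (graph_of V adj)" if "e \<in> edges (graph_of V adj)" for e
  proof -
    from that obtain u v where "e = {u, v}" "u \<in> V" "v \<in> V" "u \<noteq> v" "adj u v"
      by (auto simp: edges_graph_of)
    then have "relabel p ` e = {relabel p u, relabel p v}" "relabel p u \<in> V" "relabel p v \<in> V"
        "relabel p u \<noteq> relabel p v" "adj (relabel p u) (relabel p v)"
      using relabel_closed[OF p] adj_relabel[OF p] inj by (auto simp: inj_on_def)
    then show ?thesis by (auto simp: edges_graph_of)
  qed
  moreover have "card (image (relabel p) ` M) = card M"
    by (rule card_image, rule inj_on_subset[OF inj_on_image_Pow[OF inj]]) (use V in auto)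
  moreover have "card (\<Union>(image (relabel p) ` M)) = card (\<Union>M)"
    by (subst image_Union[symmetric], rule card_image, rule inj_on_subset[OF inj V(1)])
  ultimately show ?thesis
    using M by (auto simp: matchings_def)
qed

text \<open>Matchings of the infinite graph are counted by their sets of labels; those with labels in
  \<open>{1..q}\<close> are the matchings of \<open>level q\<close>. A matching with \<open>i\<close> edges has at most \<open>2 * i * b\<close>
  labels, whatever \<open>q\<close> is.\<close>

lemma card_matchings_level_eq_poly:
  "\<exists>g :: rat poly. \<forall>q. poly g (of_nat q) = of_nat (card (matchings (level q) i))"
proof -
  let ?X = "matchings (graph_of V adj) i"
  have "\<exists>g. numerical_poly g \<and>
      (\<forall>q. poly g (of_nat q) = of_nat (card {M \<in> ?X. matching_labels M \<subseteq> {1..q}}))"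
  proof (rule card_supported_eq_numerical_poly[where N = "2 * i * b" and
        act = "\<lambda>p M. image (relabel p) ` M"])
    fix M assume M: "M \<in> ?X"
    note V = matching_vertices[OF M]
    show "finite (matching_labels M)"
      unfolding matching_labels_def
      by (rule finite_UN_I[OF V(2)]) (use V(1) finite_labels in blast)
    have "card (matching_labels M) \<le> (\<Sum>v\<in>\<Union>M. card (labels v))"
      unfolding matching_labels_def by (rule card_UN_le[OF V(2)])
    also have "\<dots> \<le> of_nat (card (\<Union>M)) * b"
      by (rule sum_bounded_above) (use V card_labels in auto)
    finally show "card (matching_labels M) \<le> 2 * i * b"
      using V(3) by simp
  next
    fix S :: "nat set" assume "finite S"
    have "{M \<in> ?X. matching_labels M \<subseteq> S} \<subseteq> Pow (Pow {v \<in> V. labels v \<subseteq> S})"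
    proof (intro subsetI PowI)
      fix M e v assume M: "M \<in> {M \<in> ?X. matching_labels M \<subseteq> S}" and "e \<in> M" "v \<in> e"
      then have "v \<in> \<Union>M" by blast
      with M matching_vertices(1)[of M i] show "v \<in> {v \<in> V. labels v \<subseteq> S}"
        unfolding matching_labels_def by blast
    qed
    then show "finite {M \<in> ?X. matching_labels M \<subseteq> S}"
      by (rule finite_subset) (simp add: finite_labelled_within[OF \<open>finite S\<close>])
  next
    fix p :: "nat \<Rightarrow> nat" and M assume p: "inj p" and M: "M \<in> ?X"
    show "image (relabel p) ` M \<in> ?X" by (rule relabel_matching[OF p M])
    have "matching_labels (image (relabel p) ` M) = (\<Union>v\<in>\<Union>M. labels (relabel p v))"
      by (auto simp: matching_labels_def)
    also have "\<dots> = (\<Union>v\<in>\<Union>M. p ` labels v)"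
      using matching_vertices(1)[OF M] labels_relabel[OF p] by (intro SUP_cong) auto
    also have "\<dots> = p ` matching_labels M"
      by (auto simp: matching_labels_def)
    finally show "matching_labels (image (relabel p) ` M) = p ` matching_labels M" .
  next
    fix p :: "nat \<Rightarrow> nat" assume "inj p"
    then have "inj_on (image (image (relabel p))) (Pow (Pow V))"
      by (intro inj_on_image_Pow inj_relabel)
    then show "inj_on (\<lambda>M. image (relabel p) ` M) ?X"
      by (rule inj_on_subset) (use matching_vertices(1) in blast)
  qed
  then show ?thesis by (auto simp: matchings_level)
qed

lemma card_verts_level_eq_numerical_poly:
  "\<exists>g. numerical_poly g \<and> (\<forall>q. poly g (of_nat q) = of_nat (card (verts (level q))))"
  unfolding level_def verts_graph_of
  by (rule card_supported_eq_numerical_poly[where act = relabel and N = b])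
    (simp_all add: finite_labels card_labels finite_labelled_within relabel_closed
      labels_relabel inj_relabel)

theorem two_level_matching_poly:
  "\<exists>g. (\<forall>q. poly g (of_nat q) = of_nat (card (verts (level q)))) \<and>
       two_level_poly_infinite_depth g (\<lambda>q. matching_poly (level q))"
proof -
  obtain g where g: "numerical_poly g"
      "\<And>q. poly g (of_nat q) = of_nat (card (verts (level q)))"
    using card_verts_level_eq_numerical_poly by blast
  obtain h :: "nat \<Rightarrow> rat poly" where
    h: "\<And>i q. poly (h i) (of_nat q) = of_nat (card (matchings (level q) i))"
    using card_matchings_level_eq_poly by metis
  define \<phi> where "\<phi> r = (if even r then smult ((-1) ^ (r div 2)) (h (r div 2)) else 0)" for r
  have "top_coeff (matching_poly (level q)) r = poly (\<phi> r) (of_nat q)" for q r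
  proof -
    have "finite (verts (level q))"
      by (simp add: level_def finite_labelled_within)
    moreover have "edges (level q) \<subseteq> Pow (verts (level q))"
      by (auto simp: level_def edges_graph_of)
    ultimately show ?thesis
      by (simp add: top_coeff_matching_poly \<phi>_def h)
  qed
  then have "two_level_poly_infinite_depth g (\<lambda>q. matching_poly (level q))"
    unfolding two_level_poly_infinite_depth_def two_level_poly_def
    using g by (auto simp: degree_matching_poly matching_poly_nonzero)
  with g show ?thesis by blast
qed

end

section \<open>The three families\<close>

text \<open>Adjacency in Kneser and Johnson graphs depends only on the size of the intersection, which an
  injection preserves. The labels of a subset are its elements.\<close>

lemma two_level_matching_poly_subsets_of_size:
  assumes adj: "\<And>p A B. inj p \<Longrightarrow> adj A B \<Longrightarrow> adj (p ` A) (p ` B)"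
  shows "\<exists>g. (\<forall>q. poly g (of_nat q) = of_nat (card (verts (graph_of (subsets_of_size q k) adj)))) \<and>
    two_level_poly_infinite_depth g (\<lambda>q. matching_poly (graph_of (subsets_of_size q k) adj))"
proof -
  interpret labelled_graph "{A. finite A \<and> card A = k}" adj "\<lambda>A. A" image k
  proof
    show "finite {A \<in> {A. finite A \<and> card A = k}. A \<subseteq> S}" if "finite S" for S :: "nat set"
      by (rule finite_subset[of _ "Pow S"]) (use that in auto)
    show "inj_on (image p) {A. finite A \<and> card A = k}" if "inj p" for p :: "nat \<Rightarrow> nat"
      by (rule inj_onI) (use that in \<open>simp add: inj_image_eq_iff\<close>)
  qed (auto simp: adj card_image inj_on_subset)
  have "level q = graph_of (subsets_of_size q k) adj" for q
    by (auto simp: level_def subsets_of_size_def finite_subset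
        intro!: arg_cong[where f = "\<lambda>V. graph_of V adj"])
  with two_level_matching_poly show ?thesis by simp
qed

text \<open>An injection applied to all entries preserves the set of coordinates where two tuples differ.
  The labels of a tuple are its entries.\<close>

lemma two_level_matching_poly_complete_power_graph:
  "\<exists>g. (\<forall>q. poly g (of_nat q) = of_nat (card (verts (complete_power_graph q k)))) \<and>
    two_level_poly_infinite_depth g (\<lambda>q. matching_poly (complete_power_graph q k))"
proof -
  let ?adj = "\<lambda>xs ys. card {i. i < k \<and> xs ! i \<noteq> ys ! i} = 1"
  interpret labelled_graph "{xs. length xs = k}" ?adj set map k
  proof
    show "finite {xs \<in> {xs. length xs = k}. set xs \<subseteq> S}" if "finite S" for S :: "nat set"
      using finite_lists_length_eq[OF that, of k] by (simp add: conj_commute)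
    show "inj_on (map p) {xs. length xs = k}" if "inj p" for p :: "nat \<Rightarrow> nat"
      using that by (meson inj_mapI inj_on_subset subset_UNIV)
    show "?adj (map p xs) (map p ys)"
      if "inj p" "xs \<in> {xs. length xs = k}" "ys \<in> {xs. length xs = k}" "?adj xs ys"
      for p :: "nat \<Rightarrow> nat" and xs ys
    proof -
      have "{i. i < k \<and> map p xs ! i \<noteq> map p ys ! i} = {i. i < k \<and> xs ! i \<noteq> ys ! i}"
        using that by (auto simp: inj_eq)
      with that show ?thesis by simp
    qed
  qed (auto simp: card_length)
  have "level q = complete_power_graph q k" for q
    unfolding level_def complete_power_graph_def by simp
  with two_level_matching_poly show ?thesis by simp
qed

theorem corollary36:
  fixes k :: nat
  assumes "k \<ge> 1"
  shows
    "(\<exists>g. (\<forall>q. poly g (of_nat q) = of_nat (card (verts (kneser_graph q k)))) \<and>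
          two_level_poly_infinite_depth g (\<lambda>q. matching_poly (kneser_graph q k))) \<and>
     (\<exists>g. (\<forall>q. poly g (of_nat q) = of_nat (card (verts (johnson_graph q k)))) \<and>
          two_level_poly_infinite_depth g (\<lambda>q. matching_poly (johnson_graph q k))) \<and>
     (\<exists>g. (\<forall>q. poly g (of_nat q) = of_nat (card (verts (complete_power_graph q k)))) \<and>
          two_level_poly_infinite_depth g (\<lambda>q. matching_poly (complete_power_graph q k)))"
proof (intro conjI two_level_matching_poly_complete_power_graph)
  show "\<exists>g. (\<forall>q. poly g (of_nat q) = of_nat (card (verts (kneser_graph q k)))) \<and>
          two_level_poly_infinite_depth g (\<lambda>q. matching_poly (kneser_graph q k))"
    unfolding kneser_graph_def
    by (rule two_level_matching_poly_subsets_of_size) (simp flip: image_Int)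
  show "\<exists>g. (\<forall>q. poly g (of_nat q) = of_nat (card (verts (johnson_graph q k)))) \<and>
          two_level_poly_infinite_depth g (\<lambda>q. matching_poly (johnson_graph q k))"
    unfolding johnson_graph_def
    by (rule two_level_matching_poly_subsets_of_size)
      (simp add: card_image inj_on_subset flip: image_Int)
qed

end
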